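(* For all distinct points $x,y\in\mathbb{B}^n$, $$\sinh\frac{h_{\mathbb{B}^n}(x,y)}{2}=\sqrt{1-m_1^2}\;\sinh\frac{\rho_{\mathbb{B}^n}(x,y)}{2},$$ where $m_1$ is the Euclidean distance from the origin to the line $L(x,y)$.
   Context: Let $n\ge 2$ and let $\mathbb{B}^n$ be the open Euclidean unit ball in $\mathbb{R}^n$, with boundary sphere $S^{n-1}$. For distinct $x,y\in\mathbb{R}^n$, $L(x,y)$ denotes the Euclidean line through $x$ and $y$. Hilbert metric: for distinct $x,y\in\mathbb{B}^n$, $$h_{\mathbb{B}^n}(x,y)=\log\frac{|u-y|\,|x-v|}{|u-x|\,|y-v|},$$ where $u,v$ are the two points of $L(x,y)\cap S^{n-1}$, ordered so that $|u-x|<|u-y|$; and $h_{\mathbb{B}^n}(x,x)=0$. The logarithm is natural. Hyperbolic metric: $\rho_{\mathbb{B}^n}(x,y)\ge 0$ is defined by $$\sinh^2\frac{\rho_{\mathbb{B}^n}(x,y)}{2}=\frac{|x-y|^2}{(1-|x|^2)(1-|y|^2)},\qquad x,y\in\mathbb{B}^n.$$ *)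

theory Defs
  imports "HOL-Analysis.Analysis"
begin

text \<open>
  Both distances are given by definite descriptions, which are meaningful for points
  of the open unit ball only.  For distinct \<open>x\<close>, \<open>y\<close> in the ball the line
  \<open>affine hull {x, y}\<close> meets the unit sphere in exactly two points, and the order
  condition picks out which of them is \<open>u\<close>.
\<close>

definition hilbert_dist :: "'a::euclidean_space \<Rightarrow> 'a \<Rightarrow> real" where
  "hilbert_dist x y =
    (if x = y then 0
     else (THE h. \<exists>u v. u \<noteq> v \<and> affine hull {x, y} \<inter> sphere 0 1 = {u, v} \<and>
             norm (u - x) < norm (u - y) \<and>
             h = ln ((norm (u - y) * norm (x - v)) / (norm (u - x) * norm (y - v)))))"

definition hyperbolic_dist :: "'a::euclidean_space \<Rightarrow> 'a \<Rightarrow> real" where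
  "hyperbolic_dist x y =
    (THE r. 0 \<le> r \<and>
       (sinh (r / 2))\<^sup>2 = (norm (x - y))\<^sup>2 / ((1 - (norm x)\<^sup>2) * (1 - (norm y)\<^sup>2)))"

end

theory Submission
  imports Defs
begin

text \<open>
  Every quantity in the identity becomes a rational function of real coordinates on the line
  \<open>L(x,y)\<close>.  Let \<open>p\<close> be the foot of the perpendicular from the origin and \<open>d\<close> a
  unit vector along the line, so that \<open>x = p + a d\<close> and \<open>y = p + b d\<close> with \<open>a < b\<close>.
  By Pythagoras \<open>m\<^sub>1 = |p|\<close>, and with \<open>c\<^sup>2 = 1 - |p|\<^sup>2\<close> the line meets the
  sphere at the parameters \<open>-c\<close> and \<open>c\<close>, while \<open>1 - |p + t d|\<^sup>2 = c\<^sup>2 - t\<^sup>2\<close>.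

  The Hilbert distance is then the logarithm of \<open>R = (c + b) (c - a) / ((c + a) (c - b))\<close>, and
  \<open>sinh\<^sup>2 (ln R / 2) = (R - 1)\<^sup>2 / (4 R) = c\<^sup>2 (b - a)\<^sup>2 / ((c\<^sup>2 - a\<^sup>2) (c\<^sup>2 - b\<^sup>2))\<close>,
  because the numerator of \<open>R - 1\<close> collapses to \<open>2 c (b - a)\<close>.  The factors other than
  \<open>c\<^sup>2\<close> are exactly \<open>sinh\<^sup>2 (\<rho> / 2)\<close>, and taking square roots of nonnegative numbers
  gives the claim.
\<close>

lemma line_through_foot_of_perpendicular:
  fixes x y :: "'a::euclidean_space"
  assumes "x \<noteq> y"
  obtains p d a b where "norm d = 1" "p \<bullet> d = 0" "a < b" "x = p + a *\<^sub>R d" "y = p + b *\<^sub>R d"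
    "affine hull {x, y} = range (\<lambda>t. p + t *\<^sub>R d)"
proof -
  define l where "l = norm (y - x)"
  define d where "d = (1 / l) *\<^sub>R (y - x)"
  define a where "a = x \<bullet> d"
  define p where "p = x - a *\<^sub>R d"
  have l: "l > 0" using assms by (simp add: l_def)
  have d: "norm d = 1" using l by (simp add: d_def l_def)
  have dd: "d \<bullet> d = 1" using d by (simp add: dot_square_norm)
  have ld: "y - x = l *\<^sub>R d" using l by (simp add: d_def)
  have "p \<bullet> d = 0" by (simp add: p_def inner_diff_left dd a_def)
  moreover have x: "x = p + a *\<^sub>R d" by (simp add: p_def)
  moreover have y: "y = p + (a + l) *\<^sub>R d"
    using ld by (simp add: p_def algebra_simps)
  moreover have "affine hull {x, y} = range (\<lambda>t. p + t *\<^sub>R d)"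
  proof -
    have 1: "x + s *\<^sub>R (y - x) = p + (a + s * l) *\<^sub>R d" for s
      by (simp add: ld) (simp add: p_def algebra_simps)
    have 2: "p + t *\<^sub>R d = x + ((t - a) / l) *\<^sub>R (y - x)" for t
      using l by (simp add: 1)
    show ?thesis
      unfolding affine_hull_2_alt
    proof (rule antisym; rule image_subsetI)
      fix s show "x + s *\<^sub>R (y - x) \<in> range (\<lambda>t. p + t *\<^sub>R d)"
        unfolding 1 by (rule rangeI)
      show "p + s *\<^sub>R d \<in> range (\<lambda>s. x + s *\<^sub>R (y - x))"
        unfolding 2 by (rule rangeI)
    qed
  qed
  ultimately show thesis using that[of d p a "a + l"] d l by simp
qed

lemma norm_orthogonal_line:
  fixes p d :: "'a::real_inner"
  assumes "norm d = 1" "p \<bullet> d = 0"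
  shows "(norm (p + t *\<^sub>R d))\<^sup>2 = (norm p)\<^sup>2 + t\<^sup>2"
proof -
  have "d \<bullet> d = 1" "d \<bullet> p = 0" using assms by (simp_all add: norm_eq_1 inner_commute)
  then show ?thesis
    unfolding power2_norm_eq_inner
    by (simp add: assms inner_add_left inner_add_right power2_eq_square)
qed

lemma infdist_origin_line:
  fixes p d :: "'a::real_inner"
  assumes "norm d = 1" "p \<bullet> d = 0"
  shows "infdist 0 (range (\<lambda>t. p + t *\<^sub>R d)) = norm p"
proof (rule antisym)
  show "infdist 0 (range (\<lambda>t. p + t *\<^sub>R d)) \<le> norm p"
    using infdist_le[of "p + 0 *\<^sub>R d" "range (\<lambda>t. p + t *\<^sub>R d)" 0] by (force simp: dist_norm)
  have "norm p \<le> norm (p + t *\<^sub>R d)" for t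
    by (rule power2_le_imp_le) (simp_all add: norm_orthogonal_line[OF assms])
  then show "norm p \<le> infdist 0 (range (\<lambda>t. p + t *\<^sub>R d))"
    unfolding infdist_def by (auto intro!: cINF_greatest)
qed

lemma line_meets_unit_sphere:
  fixes p d :: "'a::euclidean_space"
  assumes "norm d = 1" "p \<bullet> d = 0" "c\<^sup>2 = 1 - (norm p)\<^sup>2"
  shows "range (\<lambda>t. p + t *\<^sub>R d) \<inter> sphere 0 1 = {p + (- c) *\<^sub>R d, p + c *\<^sub>R d}"
proof -
  have "norm (p + t *\<^sub>R d) = 1 \<longleftrightarrow> t = - c \<or> t = c" for t
  proof -
    have "norm (p + t *\<^sub>R d) = 1 \<longleftrightarrow> (norm (p + t *\<^sub>R d))\<^sup>2 = 1"
      by (simp add: power2_eq_1_iff) (smt (verit) norm_ge_zero)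
    also have "\<dots> \<longleftrightarrow> t\<^sup>2 = c\<^sup>2"
      using assms(3) by (auto simp: norm_orthogonal_line[OF assms(1,2)])
    finally show ?thesis by (auto simp: power2_eq_iff)
  qed
  then show ?thesis by (auto simp del: scaleR_minus_left)
qed

text \<open>
  The definite description is resolved here.  The two intersection points are determined as a
  set, and swapping them would violate the order condition, because the endpoint at \<open>c\<close> is
  closer to the point with the larger parameter \<open>b\<close>.
\<close>

lemma hilbert_dist_in_line_coordinates:
  fixes p d :: "'a::euclidean_space"
  assumes d: "norm d = 1" and pd: "p \<bullet> d = 0" and c: "c\<^sup>2 = 1 - (norm p)\<^sup>2"
    and ab: "- c < a" "a < b" "b < c"
    and x: "x = p + a *\<^sub>R d" and y: "y = p + b *\<^sub>R d"
    and hull: "affine hull {x, y} = range (\<lambda>t. p + t *\<^sub>R d)"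
  shows "hilbert_dist x y = ln ((c + b) * (c - a) / ((c + a) * (c - b)))"
proof -
  define U V where "U = p + (- c) *\<^sub>R d" and "V = p + c *\<^sub>R d"
  have dist_line: "norm ((p + s *\<^sub>R d) - (p + t *\<^sub>R d)) = \<bar>s - t\<bar>" for s t
  proof -
    have "(p + s *\<^sub>R d) - (p + t *\<^sub>R d) = (s - t) *\<^sub>R d" by (simp add: algebra_simps)
    then show ?thesis using d by simp
  qed
  have n: "norm (U - x) = c + a" "norm (U - y) = c + b" "norm (V - x) = c - a"
    "norm (V - y) = c - b" "norm (x - V) = c - a" "norm (y - V) = c - b"
    unfolding U_def V_def x y dist_line using ab by linarith+
  have UV: "U \<noteq> V"
  proof
    assume "U = V"
    then have "c + a = c - a" "c + b = c - b" using n(1-4) by metis+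
    then show False using ab by linarith
  qed
  have xy: "x \<noteq> y"
  proof
    assume "x = y"
    then have "c + a = c + b" using n(1,2) by metis
    then show False using ab by linarith
  qed
  have S: "affine hull {x, y} \<inter> sphere 0 1 = {U, V}"
    unfolding hull U_def V_def by (rule line_meets_unit_sphere[OF d pd c])
  have orient: "u = U \<and> v = V" if "{U, V} = {u, v}" "norm (u - x) < norm (u - y)" for u v
  proof -
    have "\<not> norm (V - x) < norm (V - y)" using n(3,4) ab by linarith
    then have "u \<noteq> V" using that(2) by metis
    then show ?thesis using that(1) unfolding doubleton_eq_iff by blast
  qed
  show ?thesis
    unfolding hilbert_dist_def S if_not_P[OF xy]
  proof (rule the_equality)
    show "\<exists>u v. u \<noteq> v \<and> {U, V} = {u, v} \<and> norm (u - x) < norm (u - y) \<and>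
        ln ((c + b) * (c - a) / ((c + a) * (c - b))) =
        ln (norm (u - y) * norm (x - v) / (norm (u - x) * norm (y - v)))"
    proof (intro exI conjI)
      show "U \<noteq> V" by (rule UV)
      show "{U, V} = {U, V}" ..
      show "norm (U - x) < norm (U - y)" using n(1,2) ab by linarith
      show "ln ((c + b) * (c - a) / ((c + a) * (c - b))) =
          ln (norm (U - y) * norm (x - V) / (norm (U - x) * norm (y - V)))"
        by (simp only: n)
    qed
    fix h
    assume "\<exists>u v. u \<noteq> v \<and> {U, V} = {u, v} \<and> norm (u - x) < norm (u - y) \<and>
        h = ln (norm (u - y) * norm (x - v) / (norm (u - x) * norm (y - v)))"
    then obtain u v where uv: "{U, V} = {u, v}" "norm (u - x) < norm (u - y)"
      and h: "h = ln (norm (u - y) * norm (x - v) / (norm (u - x) * norm (y - v)))"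
      by (elim exE conjE)
    have "u = U" "v = V" using orient[OF uv] by simp_all
    then show "h = ln ((c + b) * (c - a) / ((c + a) * (c - b)))"
      unfolding h by (simp only: n)
  qed
qed

lemma sinh_half_ln_squared:
  fixes R :: real
  assumes "R > 0"
  shows "(sinh (ln R / 2))\<^sup>2 = (R - 1)\<^sup>2 / (4 * R)"
proof -
  have "cosh (ln R) = 2 * (sinh (ln R / 2))\<^sup>2 + 1"
    using cosh_double[of "ln R / 2"] by (simp add: cosh_square_eq)
  then have "2 * (sinh (ln R / 2))\<^sup>2 = (R + inverse R) / 2 - 1"
    using cosh_ln_real[OF assms] by linarith
  then show ?thesis using assms by (simp add: field_simps power2_eq_square)
qed

text \<open>
  Numerator \<open>N\<close> and denominator \<open>D\<close> of the cross ratio satisfy \<open>N - D = 2 c (b - a)\<close>,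
  while regrouping the factors of \<open>N D\<close> separates \<open>a\<close> from \<open>b\<close>.
\<close>

lemma sinh_half_ln_cross_ratio:
  fixes a b c :: real
  assumes "- c < a" "a < b" "b < c"
  shows "(sinh (ln ((c + b) * (c - a) / ((c + a) * (c - b))) / 2))\<^sup>2 =
    c\<^sup>2 * ((b - a)\<^sup>2 / ((c\<^sup>2 - a\<^sup>2) * (c\<^sup>2 - b\<^sup>2)))"
proof -
  define N D where "N = (c + b) * (c - a)" and "D = (c + a) * (c - b)"
  have pos: "N > 0" "D > 0" using assms by (auto simp: N_def D_def)
  have "(sinh (ln (N / D) / 2))\<^sup>2 = (N / D - 1)\<^sup>2 / (4 * (N / D))"
    using pos by (intro sinh_half_ln_squared) simp
  also have "\<dots> = (N - D)\<^sup>2 / (4 * (N * D))"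
    using pos by (simp add: field_simps power2_eq_square)
  also have "N - D = 2 * (c * (b - a))" by (simp add: N_def D_def algebra_simps)
  also have "N * D = (c\<^sup>2 - a\<^sup>2) * (c\<^sup>2 - b\<^sup>2)"
    by (simp add: N_def D_def algebra_simps power2_eq_square)
  finally show ?thesis by (simp add: N_def D_def power_mult_distrib)
qed

lemma sinh_half_hyperbolic_dist:
  fixes x y :: "'a::euclidean_space"
  assumes "norm x < 1" "norm y < 1"
  shows "sinh (hyperbolic_dist x y / 2) =
    sqrt ((norm (x - y))\<^sup>2 / ((1 - (norm x)\<^sup>2) * (1 - (norm y)\<^sup>2)))"
proof -
  define q where "q = (norm (x - y))\<^sup>2 / ((1 - (norm x)\<^sup>2) * (1 - (norm y)\<^sup>2))"
  have "(norm x)\<^sup>2 < 1" "(norm y)\<^sup>2 < 1" using assms by (simp_all add: power_less_one_iff)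
  then have q: "q \<ge> 0" by (simp add: q_def)
  have "hyperbolic_dist x y = 2 * arsinh (sqrt q)"
    unfolding hyperbolic_dist_def q_def[symmetric]
  proof (rule the_equality)
    show "0 \<le> 2 * arsinh (sqrt q) \<and> (sinh (2 * arsinh (sqrt q) / 2))\<^sup>2 = q"
      using q by (simp flip: not_less)
    fix r assume r: "0 \<le> r \<and> (sinh (r / 2))\<^sup>2 = q"
    then have "sinh (r / 2) = sqrt q" by (metis real_sqrt_unique sinh_real_nonneg_iff
          divide_nonneg_nonneg zero_le_numeral)
    then show "r = 2 * arsinh (sqrt q)" by (metis arsinh_sinh_real mult.commute
          nonzero_eq_divide_eq zero_neq_numeral)
  qed
  then show ?thesis by (simp add: q_def)
qed

theorem theorem1p2:
  fixes x y :: "real ^ 'n"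
  assumes "CARD('n) \<ge> 2"
    and "x \<in> ball 0 1" and "y \<in> ball 0 1" and "x \<noteq> y"
  shows "sinh (hilbert_dist x y / 2) =
    sqrt (1 - (infdist 0 (affine hull {x, y}))\<^sup>2) * sinh (hyperbolic_dist x y / 2)"
proof -
  obtain p d a b where d: "norm d = 1" and pd: "p \<bullet> d = 0" and ab: "a < b"
    and x: "x = p + a *\<^sub>R d" and y: "y = p + b *\<^sub>R d"
    and hull: "affine hull {x, y} = range (\<lambda>t. p + t *\<^sub>R d)"
    by (rule line_through_foot_of_perpendicular[OF \<open>x \<noteq> y\<close>])
  \<comment> \<open>half the length of the chord that the line cuts out of the ball\<close>
  define c where "c = sqrt (1 - (norm p)\<^sup>2)"
  have ball: "norm x < 1" "norm y < 1" using assms by auto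
  have nx: "(norm x)\<^sup>2 = (norm p)\<^sup>2 + a\<^sup>2" and ny: "(norm y)\<^sup>2 = (norm p)\<^sup>2 + b\<^sup>2"
    unfolding x y by (rule norm_orthogonal_line[OF d pd])+
  have lt1: "(norm x)\<^sup>2 < 1" "(norm y)\<^sup>2 < 1" using ball by (simp_all add: power_less_one_iff)
  have "(norm p)\<^sup>2 < 1" using lt1 nx zero_le_power2[of a] by linarith
  then have c: "c\<^sup>2 = 1 - (norm p)\<^sup>2" "c \<ge> 0" by (simp_all add: c_def)
  have abc: "\<bar>a\<bar> < c" "\<bar>b\<bar> < c"
    by (rule power2_less_imp_less; use lt1 nx ny c in \<open>simp only: power2_abs; linarith\<close>)+
  then have order: "- c < a" "a < b" "b < c" using ab by auto
  have h: "hilbert_dist x y = ln ((c + b) * (c - a) / ((c + a) * (c - b)))"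
    by (rule hilbert_dist_in_line_coordinates[OF d pd c(1) order x y hull])
  define q where "q = (b - a)\<^sup>2 / ((c\<^sup>2 - a\<^sup>2) * (c\<^sup>2 - b\<^sup>2))"
  have "y - x = (b - a) *\<^sub>R d" by (simp add: x y algebra_simps)
  then have "norm (x - y) = b - a" using d ab by (metis abs_of_pos diff_gt_0_iff_gt mult.right_neutral
        norm_minus_commute norm_scaleR)
  moreover have "1 - (norm x)\<^sup>2 = c\<^sup>2 - a\<^sup>2" "1 - (norm y)\<^sup>2 = c\<^sup>2 - b\<^sup>2"
    using nx ny c(1) by linarith+
  ultimately have \<rho>: "sinh (hyperbolic_dist x y / 2) = sqrt q"
    using sinh_half_hyperbolic_dist[OF ball] by (simp only: q_def)
  \<comment> \<open>so that \<open>sinh (h / 2)\<close> is the nonnegative root of its square\<close>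
  have "hilbert_dist x y \<ge> 0"
  proof -
    have "(c + a) * (c - b) \<le> (c + b) * (c - a)"
      by (rule mult_mono) (use order in linarith)+
    moreover have "0 < (c + a) * (c - b)"
      by (rule mult_pos_pos) (use order in linarith)+
    ultimately show ?thesis
      unfolding h by (intro ln_ge_zero) (simp only: le_divide_eq_1_pos)
  qed
  then have "sinh (hilbert_dist x y / 2) = sqrt ((sinh (hilbert_dist x y / 2))\<^sup>2)" by simp
  also have "\<dots> = sqrt (c\<^sup>2 * q)"
    unfolding h sinh_half_ln_cross_ratio[OF order] q_def ..
  also have "\<dots> = c * sinh (hyperbolic_dist x y / 2)"
    using c(2) \<rho> by (simp add: real_sqrt_mult)
  also have "c = sqrt (1 - (infdist 0 (affine hull {x, y}))\<^sup>2)"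
    unfolding hull infdist_origin_line[OF d pd] c_def ..
  finally show ?thesis .
qed

end
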